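(* Let $q$ be a connected, simple, undirected labeled graph, let $maxL\ge 1$ be an integer, and let $\mathcal{P}_q$ be the set of simple paths of $q$ with at most $maxL$ edges (each path counted once, not together with its reversal). Run the following procedure Cover: sort $\mathcal{P}_q$ in decreasing order of number of edges; set $DP=\emptyset$ and $q'=q$; for each $p\in\mathcal{P}_q$ in this order, if every edge of $p$ is an edge of $q'$ and $q'\setminus p$ is connected, then replace $q'$ by $q'\setminus p$ and add $p$ to $DP$; stop when $q'$ is the empty graph; return $DP=DP_{maxL}(q)$. Then the returned set $DP_{maxL}(q)$ is a set of pairwise disjoint paths covering $q$ (every edge of $q$ lies on one of them). Moreover, if $maxL=2$, then $DP_{maxL}(q)$ is compact.
   Context: Paths in $q$ are called disjoint if they are pairwise edge-disjoint (not necessarily vertex-disjoint). For a subgraph $q'$ and a path $p$ whose edges lie in $q'$, $q'\setminus p$ denotes the graph obtained from $q'$ by deleting the edges of $p$ (and vertices left isolated); the empty graph is regarded as connected. A set of disjoint simple paths with at most $maxL$ edges covering $q$ is called compact if it has the minimum number of paths among all such decompositions of $q$ (for $maxL=2$ the paper describes this as consisting of $\lfloor |E_q|/2\rfloor$ paths of 2 edges, plus one 1-edge path when $|E_q|$ is odd).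
   Formalization: Cover here repeatedly takes the first path in the order that is removable from the current q', re-examining skipped paths; a single pass fails: on a path e1e2e3 with maxL=1 and order e2,e1,e3, edge e2 is never covered. q is finite. *)

theory Defs
  imports "HOL-Library.While_Combinator" "HOL-Library.Disjoint_Sets"
begin

record ('v, 'l) lgraph =
  verts :: "'v set"
  edges :: "'v set set"
  vlabel :: "'v \<Rightarrow> 'l"

definition simple_graph :: "('v, 'l) lgraph \<Rightarrow> bool" where
  "simple_graph q \<longleftrightarrow> finite (verts q) \<and>
     (\<forall>e\<in>edges q. \<exists>u\<in>verts q. \<exists>v\<in>verts q. u \<noteq> v \<and> e = {u, v})"

text \<open>The graph without vertices is connected under this definition.\<close>

definition connected_graph :: "('v, 'l) lgraph \<Rightarrow> bool" where
  "connected_graph q \<longleftrightarrow>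
     (\<forall>u\<in>verts q. \<forall>v\<in>verts q. (u, v) \<in> {(x, y). {x, y} \<in> edges q}\<^sup>*)"

definition empty_graph :: "('v, 'l) lgraph \<Rightarrow> bool" where
  "empty_graph q \<longleftrightarrow> verts q = {} \<and> edges q = {}"

text \<open>A simple path is given by a duplicate-free sequence of vertices with at least one edge.
  As an undirected path it is represented by its set of edges, which determines the sequence up
  to reversal, so that a path and its reversal are the same element of \<open>paths_upto\<close>.\<close>

definition simple_path :: "('v, 'l) lgraph \<Rightarrow> 'v list \<Rightarrow> bool" where
  "simple_path q vs \<longleftrightarrow> 2 \<le> length vs \<and> distinct vs \<and> set vs \<subseteq> verts q \<and>
     (\<forall>i. Suc i < length vs \<longrightarrow> {vs ! i, vs ! Suc i} \<in> edges q)"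

definition path_edges :: "'v list \<Rightarrow> 'v set set" where
  "path_edges vs = {{vs ! i, vs ! Suc i} | i. Suc i < length vs}"

definition paths_upto :: "('v, 'l) lgraph \<Rightarrow> nat \<Rightarrow> 'v set set set" where
  "paths_upto q L = {path_edges vs | vs. simple_path q vs \<and> length vs - 1 \<le> L}"

definition delete_path :: "('v, 'l) lgraph \<Rightarrow> 'v set set \<Rightarrow> ('v, 'l) lgraph" where
  "delete_path q p = q\<lparr>verts := {v \<in> verts q. \<exists>e \<in> edges q - p. v \<in> e}, edges := edges q - p\<rparr>"

definition removable :: "('v, 'l) lgraph \<Rightarrow> 'v set set \<Rightarrow> bool" where
  "removable q p \<longleftrightarrow> p \<subseteq> edges q \<and> connected_graph (delete_path q p)"

definition sorted_enumeration :: "'v set set set \<Rightarrow> 'v set set list \<Rightarrow> bool" where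
  "sorted_enumeration P ps \<longleftrightarrow>
     set ps = P \<and> distinct ps \<and> sorted_wrt (\<lambda>p p'. card p' \<le> card p) ps"

text \<open>The state is the pair of the remaining graph and the paths selected so far. Each iteration
  takes the first path in the order of \<open>ps\<close> that can be removed from the current graph. A path
  rejected earlier is therefore examined again after the graph has changed: its removal may
  disconnect the graph at first and not later. Scanning \<open>ps\<close> only once does not even cover the
  graph: on a path with three edges and \<open>L = 1\<close>, listing the middle edge first leaves that edge
  uncovered. The value is \<open>None\<close> iff the procedure does not terminate.\<close>

definition cover :: "'v set set list \<Rightarrow> ('v, 'l) lgraph \<Rightarrow> 'v set set set option" where
  "cover ps q = map_option snd (while_option
     (\<lambda>(q', DP). \<not> empty_graph q' \<and> find (removable q') ps \<noteq> None)
     (\<lambda>(q', DP). let p = the (find (removable q') ps) in (delete_path q' p, insert p DP))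
     (q, {}))"

definition disjoint_path_cover :: "('v, 'l) lgraph \<Rightarrow> nat \<Rightarrow> 'v set set set \<Rightarrow> bool" where
  "disjoint_path_cover q L DP \<longleftrightarrow>
     DP \<subseteq> paths_upto q L \<and> disjoint DP \<and> (\<forall>e\<in>edges q. \<exists>p\<in>DP. e \<in> p)"

definition compact_path_cover :: "('v, 'l) lgraph \<Rightarrow> nat \<Rightarrow> 'v set set set \<Rightarrow> bool" where
  "compact_path_cover q L DP \<longleftrightarrow> disjoint_path_cover q L DP \<and>
     (\<forall>DP'. disjoint_path_cover q L DP' \<longrightarrow> card DP \<le> card DP')"

end

theory Submission
  imports Defs
begin

text \<open>Two distinct edges of a simple graph form a simple path iff they meet, and deleting edges
  leaves a connected graph iff the remaining edges are connected in the line graph. In a finite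
  connected graph, a vertex at maximal distance from a fixed root can be removed without
  disconnecting it, so the procedure never gets stuck while edges remain.

  The line graph is claw-free, and a connected claw-free graph with at least two vertices stays
  connected after removing some two adjacent ones (an argument of Sumner). Let \<open>u\<close> be the
  predecessor of a farthest vertex \<open>v\<close>. Two adjacent farthest neighbours of \<open>u\<close> can be removed
  together. If there are none, claw-freeness leaves \<open>v\<close> as the only farthest neighbour of \<open>u\<close>
  unless \<open>u\<close> is the root, in which case there is at most one vertex besides \<open>u\<close> and \<open>v\<close>; either
  way \<open>u\<close> and \<open>v\<close> can be removed. So for \<open>maxL = 2\<close> every chosen path has two edges, except
  the last one if the number of edges is odd.\<close>

section \<open>Removing vertices from connected graphs\<close>

text \<open>Walks are confined to \<open>S\<close> by \<open>Restr\<close>, so deleting vertices is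
  set difference with \<open>R\<close> kept fixed. The empty set counts as connected.\<close>

definition connected_in :: "'a rel \<Rightarrow> 'a set \<Rightarrow> bool" where
  "connected_in R S \<longleftrightarrow> (\<forall>x\<in>S. \<forall>y\<in>S. (x, y) \<in> (Restr R S)\<^sup>*)"

definition claw_free_on :: "'a rel \<Rightarrow> 'a set \<Rightarrow> bool" where
  "claw_free_on R S \<longleftrightarrow> (\<forall>c\<in>S. \<forall>x\<in>S. \<forall>y\<in>S. \<forall>z\<in>S.
     (c, x) \<in> R \<and> (c, y) \<in> R \<and> (c, z) \<in> R \<and> x \<noteq> y \<and> x \<noteq> z \<and> y \<noteq> z \<longrightarrow>
     (x, y) \<in> R \<or> (x, z) \<in> R \<or> (y, z) \<in> R)"

lemma claw_free_onD:
  assumes "claw_free_on R S" "c \<in> S" "x \<in> S" "y \<in> S" "z \<in> S"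
    and "(c, x) \<in> R" "(c, y) \<in> R" "(c, z) \<in> R" "x \<noteq> y" "x \<noteq> z" "y \<noteq> z"
  shows "(x, y) \<in> R \<or> (x, z) \<in> R \<or> (y, z) \<in> R"
  using assms unfolding claw_free_on_def by simp

text \<open>The function is the distance from \<open>r\<close> inside \<open>S\<close>. Later
  arguments use only that it vanishes at the root, that every other vertex has a predecessor one
  layer closer, and that an edge raises it by at most one.\<close>

lemma connected_in_obtains_distance:
  assumes conn: "connected_in R S" and "r \<in> S"
  obtains d :: "'a \<Rightarrow> nat" where "d r = 0"
    and "\<forall>x\<in>S. x \<noteq> r \<longrightarrow> (\<exists>y\<in>S. (y, x) \<in> R \<and> Suc (d y) = d x)"
    and "\<forall>x\<in>S. \<forall>y\<in>S. (x, y) \<in> R \<longrightarrow> d y \<le> Suc (d x)"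
proof -
  define T where "T = Restr R S"
  define d where "d x = (LEAST n. (r, x) \<in> T ^^ n)" for x
  have reach: "(r, x) \<in> T ^^ d x" if "x \<in> S" for x
  proof -
    have "(r, x) \<in> T\<^sup>*"
      using conn \<open>r \<in> S\<close> that by (simp add: connected_in_def T_def)
    then obtain n where "(r, x) \<in> T ^^ n"
      using rtrancl_imp_relpow by blast
    then show ?thesis
      unfolding d_def by (rule LeastI)
  qed
  have least: "d x \<le> n" if "(r, x) \<in> T ^^ n" for x n
    unfolding d_def using that by (rule Least_le)
  have step: "d y \<le> Suc (d x)" if "x \<in> S" "y \<in> S" "(x, y) \<in> R" for x y
    using that reach[of x] by (intro least) (auto simp: T_def)
  show thesis
  proof (rule that[of d])
    show "d r = 0"
      using least[of r 0] by simp
    have "\<exists>y\<in>S. (y, x) \<in> R \<and> Suc (d y) = d x" if "x \<in> S" "x \<noteq> r" for x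
    proof (cases "d x")
      case 0
      with reach[OF \<open>x \<in> S\<close>] \<open>x \<noteq> r\<close> show ?thesis by simp
    next
      case (Suc n)
      with reach[OF \<open>x \<in> S\<close>] obtain y where y: "(r, y) \<in> T ^^ n" "(y, x) \<in> T"
        by auto
      from y(2) have "y \<in> S" "(y, x) \<in> R" by (auto simp: T_def)
      moreover have "Suc (d y) = d x"
        using least[OF y(1)] step[of y x] calculation that Suc by simp
      ultimately show ?thesis by blast
    qed
    then show "\<forall>x\<in>S. x \<noteq> r \<longrightarrow> (\<exists>y\<in>S. (y, x) \<in> R \<and> Suc (d y) = d x)" by blast
  qed (use step in blast)
qed

text \<open>Descending along \<open>d\<close> must end at \<open>r\<close>, since \<open>d\<close>
  takes natural values. In the applications \<open>d\<close> is the distance measured before a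
  deletion, so it is enough that each remaining vertex keeps a predecessor.\<close>

lemma connected_in_if_descending:
  fixes d :: "'a \<Rightarrow> nat"
  assumes "sym R"
    and desc: "\<And>x. x \<in> S \<Longrightarrow> x \<noteq> r \<Longrightarrow> \<exists>y\<in>S. (y, x) \<in> R \<and> d y < d x"
  shows "connected_in R S"
proof -
  let ?T = "Restr R S"
  have "sym (?T\<^sup>*)"
    using \<open>sym R\<close> by (intro sym_rtrancl) (auto simp: sym_def)
  have root: "(r, x) \<in> ?T\<^sup>*" if "x \<in> S" for x
    using that
  proof (induction "d x" arbitrary: x rule: less_induct)
    case less
    show ?case
    proof (cases "x = r")
      case False
      then obtain y where y: "y \<in> S" "(y, x) \<in> R" "d y < d x"
        using desc less.prems by blast
      then have "(r, y) \<in> ?T\<^sup>*" using less.hyps by blast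
      then show ?thesis
        by (rule rtrancl_into_rtrancl) (use y less.prems in auto)
    qed simp
  qed
  show ?thesis
    unfolding connected_in_def
    using root \<open>sym (?T\<^sup>*)\<close> by (meson rtrancl_trans symE)
qed

lemma ex_farthest:
  fixes d :: "'a \<Rightarrow> nat"
  assumes "finite S" "x \<in> S"
  obtains v where "v \<in> S" "\<forall>y\<in>S. d y \<le> d v"
proof -
  have "Max (d ` S) \<in> d ` S"
    using assms by (intro Max_in) auto
  then obtain v where "v \<in> S" "d v = Max (d ` S)" by auto
  with \<open>finite S\<close> show thesis by (intro that[of v]) auto
qed

lemma connected_in_ex_removable:
  assumes "finite S" "S \<noteq> {}" "sym R" "connected_in R S"
  obtains x where "x \<in> S" "connected_in R (S - {x})"
proof -
  obtain r where "r \<in> S" using \<open>S \<noteq> {}\<close> by blast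
  obtain d :: "'a \<Rightarrow> nat" where "d r = 0"
    and pred: "\<forall>x\<in>S. x \<noteq> r \<longrightarrow> (\<exists>y\<in>S. (y, x) \<in> R \<and> Suc (d y) = d x)"
    and "\<forall>x\<in>S. \<forall>y\<in>S. (x, y) \<in> R \<longrightarrow> d y \<le> Suc (d x)"
    using connected_in_obtains_distance[OF \<open>connected_in R S\<close> \<open>r \<in> S\<close>] by blast
  obtain v where v: "v \<in> S" "\<forall>y\<in>S. d y \<le> d v"
    using ex_farthest[OF \<open>finite S\<close> \<open>r \<in> S\<close>] by blast
  have "connected_in R (S - {v})"
  proof (rule connected_in_if_descending[OF \<open>sym R\<close>])
    fix x assume "x \<in> S - {v}" "x \<noteq> r"
    then obtain y where y: "y \<in> S" "(y, x) \<in> R" "Suc (d y) = d x"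
      using pred by blast
    \<comment> \<open>A farthest vertex is nobody's predecessor.\<close>
    then have "y \<noteq> v"
      using v(2) \<open>x \<in> S - {v}\<close> by auto
    with y show "\<exists>y\<in>S - {v}. (y, x) \<in> R \<and> d y < d x" by auto
  qed
  with v show thesis by (intro that)
qed

lemma claw_free_ex_removable_pair:
  assumes "finite S" "2 \<le> card S" "sym R" "connected_in R S" and claw: "claw_free_on R S"
  obtains x y where "x \<in> S" "y \<in> S" "x \<noteq> y" "(x, y) \<in> R" "connected_in R (S - {x, y})"
proof -
  obtain r where "r \<in> S" using \<open>2 \<le> card S\<close> by fastforce
  obtain d :: "'a \<Rightarrow> nat" where d0: "d r = 0"
    and pred: "\<forall>x\<in>S. x \<noteq> r \<longrightarrow> (\<exists>y\<in>S. (y, x) \<in> R \<and> Suc (d y) = d x)"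
    and step: "\<forall>x\<in>S. \<forall>y\<in>S. (x, y) \<in> R \<longrightarrow> d y \<le> Suc (d x)"
    using connected_in_obtains_distance[OF \<open>connected_in R S\<close> \<open>r \<in> S\<close>] by blast
  obtain v where v: "v \<in> S" and far: "\<forall>y\<in>S. d y \<le> d v"
    using ex_farthest[OF \<open>finite S\<close> \<open>r \<in> S\<close>] by blast
  \<comment> \<open>A second vertex forces a positive maximal distance, so \<open>v\<close> is not
    the root and has a predecessor \<open>u\<close>.\<close>
  have "S \<noteq> {r}" using \<open>2 \<le> card S\<close> by auto
  then obtain s where "s \<in> S" "s \<noteq> r" using \<open>r \<in> S\<close> by blast
  with pred far have "0 < d v" by (metis less_le_trans zero_less_Suc)
  with d0 have "v \<noteq> r" by auto
  with pred v obtain u where u: "u \<in> S" "(u, v) \<in> R" "Suc (d u) = d v" by blast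
  define C where "C = {x \<in> S. d x = d v \<and> (u, x) \<in> R}"
  have "v \<in> C" using u v by (simp add: C_def)
  have sym: "(y, x) \<in> R" if "(x, y) \<in> R" for x y
    using \<open>sym R\<close> that by (rule symD)
  note found = that
  \<comment> \<open>Both vertices lie in the last layer, so no other vertex loses its
    predecessor.\<close>
  have siblings: thesis if "x \<in> C" "y \<in> C" "x \<noteq> y" "(x, y) \<in> R" for x y
  proof (rule found[of x y])
    show "connected_in R (S - {x, y})"
    proof (rule connected_in_if_descending[OF \<open>sym R\<close>])
      fix z assume z: "z \<in> S - {x, y}" "z \<noteq> r"
      then obtain w where w: "w \<in> S" "(w, z) \<in> R" "Suc (d w) = d z"
        using pred by blast
      then have "w \<noteq> x \<and> w \<noteq> y"
        using far z that by (auto simp: C_def)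
      with w show "\<exists>w\<in>S - {x, y}. (w, z) \<in> R \<and> d w < d z" by auto
    qed
  qed (use that in \<open>auto simp: C_def\<close>)
  have uv: "u \<noteq> v" using u by auto
  \<comment> \<open>If \<open>u\<close> is the root, the last layer is at distance 1, so every
    vertex other than the root is adjacent to it.\<close>
  have C_if_root: "z \<in> C" if z: "u = r" "z \<in> S" "z \<noteq> r" for z
  proof -
    obtain w where w: "w \<in> S" "(w, z) \<in> R" "Suc (d w) = d z"
      using pred z by blast
    then have "d w = 0" using bspec[OF far z(2)] u d0 z(1) by auto
    then have "w = r" using pred \<open>w \<in> S\<close> by auto
    then show ?thesis using w z u by (simp add: C_def)
  qed
  show thesis
  proof (cases "\<exists>x\<in>C. \<exists>y\<in>C. x \<noteq> y \<and> (x, y) \<in> R")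
    case True
    then show ?thesis using siblings by blast
  next
    case indep: False
    have "connected_in R (S - {u, v})"
    proof (cases "u = r")
      case True
      \<comment> \<open>Otherwise \<open>x\<close>, \<open>y\<close> and \<open>v\<close> are three
        neighbours of \<open>u\<close>, and claw-freeness puts an edge inside
        \<open>C\<close>.\<close>
      have "x = y" if "x \<in> S - {u, v}" "y \<in> S - {u, v}" for x y
      proof (rule ccontr)
        assume "x \<noteq> y"
        have "x \<in> C" "y \<in> C" using C_if_root True that by auto
        then have "(x, y) \<in> R \<or> (x, v) \<in> R \<or> (y, v) \<in> R"
          using claw_free_onD[OF claw u(1) _ _ v, of x y] \<open>x \<noteq> y\<close> that u(2) by (simp add: C_def)
        with indep \<open>x \<in> C\<close> \<open>y \<in> C\<close> \<open>v \<in> C\<close> \<open>x \<noteq> y\<close> that show False by blast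
      qed
      then show ?thesis
        unfolding connected_in_def by blast
    next
      case False
      then obtain w where w: "w \<in> S" "(w, u) \<in> R" "Suc (d w) = d u"
        using pred u by blast
      \<comment> \<open>A second element \<open>x\<close> would give a claw at \<open>u\<close> with
        leaves \<open>w\<close>, \<open>x\<close>, \<open>v\<close>: the predecessor
        \<open>w\<close> of \<open>u\<close> is two layers closer to the root than \<open>x\<close>
        and \<open>v\<close>, hence adjacent to neither.\<close>
      have C_eq: "x = v" if "x \<in> C" for x
      proof (rule ccontr)
        assume "x \<noteq> v"
        have x: "x \<in> S" "d x = d v" "(u, x) \<in> R" using that by (auto simp: C_def)
        have "(w, x) \<notin> R" "(w, v) \<notin> R"
          using step w u v x by fastforce+
        moreover have "w \<noteq> x" "w \<noteq> v" using w u x by auto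
        moreover have "(x, v) \<notin> R" using indep that \<open>v \<in> C\<close> \<open>x \<noteq> v\<close> by blast
        ultimately show False
          using claw_free_onD[OF claw, of u w x v] sym[OF w(2)] w(1) u v x \<open>x \<noteq> v\<close> by blast
      qed
      show ?thesis
      proof (rule connected_in_if_descending[OF \<open>sym R\<close>])
        fix z assume z: "z \<in> S - {u, v}" "z \<noteq> r"
        then obtain y where y: "y \<in> S" "(y, z) \<in> R" "Suc (d y) = d z"
          using pred by blast
        have "y \<noteq> v" using far y z by auto
        \<comment> \<open>A vertex with predecessor \<open>u\<close> lies in \<open>C\<close>, and
          \<open>v\<close> is the only element of \<open>C\<close>.\<close>
        moreover have "y \<noteq> u"
          using C_eq[of z] z y u by (auto simp: C_def)
        ultimately show "\<exists>y\<in>S - {u, v}. (y, z) \<in> R \<and> d y < d z"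
          using y by auto
      qed
    qed
    then show ?thesis using found u v uv by blast
  qed
qed

section \<open>The line graph\<close>

text \<open>Adjacency in the line graph, with a loop at every nonempty edge. Loops do not affect
  reachability, and the pair lemma demands distinctness separately.\<close>

definition meets :: "'v set rel" where
  "meets = {(e, f). e \<inter> f \<noteq> {}}"

lemma sym_meets: "sym meets"
  by (auto simp: sym_def meets_def)

lemma simple_graph_edgeE:
  assumes "simple_graph q" "e \<in> edges q"
  obtains u v where "u \<in> verts q" "v \<in> verts q" "u \<noteq> v" "e = {u, v}"
  using assms unfolding simple_graph_def by blast

lemma simple_graph_edge_atE:
  assumes "simple_graph q" "e \<in> edges q" "b \<in> e"
  obtains a where "a \<in> verts q" "b \<in> verts q" "a \<noteq> b" "e = {a, b}"
proof -
  obtain u v where uv: "u \<in> verts q" "v \<in> verts q" "u \<noteq> v" "e = {u, v}"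
    using assms(1,2) by (rule simple_graph_edgeE)
  with \<open>b \<in> e\<close> show thesis
    using that[of u] that[of v] by auto
qed

lemma finite_edges:
  assumes "simple_graph q"
  shows "finite (edges q)"
proof (rule finite_subset)
  show "edges q \<subseteq> Pow (verts q)"
    using assms by (auto elim: simple_graph_edgeE)
  show "finite (Pow (verts q))"
    using assms by (simp add: simple_graph_def)
qed

text \<open>Pigeonhole: of three edges meeting \<open>c\<close>, two contain the same endpoint of
  \<open>c\<close>.\<close>

lemma claw_free_line_graph:
  assumes "simple_graph q"
  shows "claw_free_on meets (edges q)"
  unfolding claw_free_on_def
proof (intro ballI impI)
  fix c x y z
  assume "c \<in> edges q" and *: "(c, x) \<in> meets \<and> (c, y) \<in> meets \<and> (c, z) \<in> meets \<and>
    x \<noteq> y \<and> x \<noteq> z \<and> y \<noteq> z"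
  obtain u v where "c = {u, v}"
    using assms \<open>c \<in> edges q\<close> by (rule simple_graph_edgeE)
  with * show "(x, y) \<in> meets \<or> (x, z) \<in> meets \<or> (y, z) \<in> meets"
    by (auto simp: meets_def)
qed

lemma connected_line_graph:
  assumes q: "simple_graph q" and "connected_graph q"
  shows "connected_in meets (edges q)"
  unfolding connected_in_def
proof (intro ballI)
  let ?T = "Restr meets (edges q)"
  fix e f assume e: "e \<in> edges q" and f: "f \<in> edges q"
  obtain u where u: "u \<in> e" "u \<in> verts q" using q e by (auto elim: simple_graph_edgeE)
  obtain v where v: "v \<in> f" "v \<in> verts q" using q f by (auto elim: simple_graph_edgeE)
  have "(u, v) \<in> {(x, y). {x, y} \<in> edges q}\<^sup>*"
    using \<open>connected_graph q\<close> u v by (simp add: connected_graph_def)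
  \<comment> \<open>Quantifying over all edges at the current endpoint lets the hypothesis at
    \<open>y\<close> apply to the next edge \<open>{y, z}\<close>, which meets every edge at
    \<open>z\<close>.\<close>
  then have "\<forall>g\<in>edges q. v \<in> g \<longrightarrow> (e, g) \<in> ?T\<^sup>*"
  proof induction
    case base
    show ?case
    proof (intro ballI impI r_into_rtrancl)
      fix g assume "g \<in> edges q" "u \<in> g"
      then show "(e, g) \<in> ?T" using e u by (auto simp: meets_def)
    qed
  next
    case (step y z)
    show ?case
    proof (intro ballI impI)
      fix g assume "g \<in> edges q" "z \<in> g"
      then have "({y, z}, g) \<in> ?T" "(e, {y, z}) \<in> ?T\<^sup>*"
        using step by (auto simp: meets_def)
      then show "(e, g) \<in> ?T\<^sup>*" by (rule rtrancl_into_rtrancl[rotated])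
    qed
  qed
  with f v show "(e, f) \<in> ?T\<^sup>*" by blast
qed

text \<open>The line graph does not see isolated vertices, hence the condition on
  \<open>verts q\<close>. After a deletion it holds because \<open>delete_path\<close> drops such
  vertices.\<close>

lemma connected_graph_if_line_graph:
  assumes q: "simple_graph q" and "verts q \<subseteq> \<Union> (edges q)"
    and conn: "connected_in meets (edges q)"
  shows "connected_graph q"
  unfolding connected_graph_def
proof (intro ballI)
  let ?R = "{(x, y). {x, y} \<in> edges q}"
  have within: "(x, y) \<in> ?R\<^sup>*" if "e \<in> edges q" "x \<in> e" "y \<in> e" for e x y
  proof (cases "x = y")
    case False
    with q that have "e = {x, y}" by (auto elim!: simple_graph_edgeE)
    with that show ?thesis by auto
  qed simp
  fix u v assume "u \<in> verts q" "v \<in> verts q"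
  then obtain e f where e: "e \<in> edges q" "u \<in> e" and f: "f \<in> edges q" "v \<in> f"
    using assms(2) by blast
  have "(e, f) \<in> (Restr meets (edges q))\<^sup>*"
    using conn e f by (simp add: connected_in_def)
  then have "\<forall>w\<in>f. (u, w) \<in> ?R\<^sup>*"
  proof induction
    case base
    show ?case using within e by blast
  next
    case (step g h)
    then obtain x where "x \<in> g" "x \<in> h" "h \<in> edges q" by (auto simp: meets_def)
    with step.IH within[of h x] show ?case by (meson rtrancl_trans)
  qed
  with f show "(u, v) \<in> ?R\<^sup>*" by blast
qed

section \<open>Deleting paths\<close>

lemma edges_delete_path [simp]: "edges (delete_path q p) = edges q - p"
  by (simp add: delete_path_def)

lemma verts_delete_path:
  "verts (delete_path q p) = {v \<in> verts q. \<exists>e\<in>edges q - p. v \<in> e}"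
  by (simp add: delete_path_def)

lemma simple_graph_delete_path:
  assumes "simple_graph q"
  shows "simple_graph (delete_path q p)"
  unfolding simple_graph_def
proof
  show "finite (verts (delete_path q p))"
    using assms by (simp add: verts_delete_path simple_graph_def)
  show "\<forall>e\<in>edges (delete_path q p). \<exists>u\<in>verts (delete_path q p).
    \<exists>v\<in>verts (delete_path q p). u \<noteq> v \<and> e = {u, v}"
  proof
    fix e assume e: "e \<in> edges (delete_path q p)"
    then have "e \<in> edges q" by simp
    with assms obtain u v where uv: "u \<in> verts q" "v \<in> verts q" "u \<noteq> v" "e = {u, v}"
      by (rule simple_graph_edgeE)
    then have "u \<in> verts (delete_path q p)" "v \<in> verts (delete_path q p)"
      using e by (auto simp: verts_delete_path)
    with uv show "\<exists>u\<in>verts (delete_path q p). \<exists>v\<in>verts (delete_path q p). u \<noteq> v \<and> e = {u, v}"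
      by blast
  qed
qed

lemma removable_if_line_graph:
  assumes "simple_graph q" "p \<subseteq> edges q" "connected_in meets (edges q - p)"
  shows "removable q p"
  unfolding removable_def using assms
  by (auto intro!: connected_graph_if_line_graph simple_graph_delete_path
      simp: verts_delete_path)

lemma path_edges_altdef: "path_edges vs = (\<lambda>i. {vs ! i, vs ! Suc i}) ` {..<length vs - 1}"
  by (auto simp: path_edges_def)

lemma
  assumes "p \<in> paths_upto q L"
  shows paths_upto_subset: "p \<subseteq> edges q"
    and paths_upto_nonempty: "p \<noteq> {}"
    and paths_upto_finite: "finite p"
    and paths_upto_card_le: "card p \<le> L"
proof -
  obtain vs where vs: "p = path_edges vs" "simple_path q vs" "length vs - 1 \<le> L"
    using assms by (auto simp: paths_upto_def)
  then show "p \<subseteq> edges q" "finite p"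
    by (auto simp: path_edges_altdef simple_path_def)
  have "0 < length vs - 1" using vs(2) by (simp add: simple_path_def)
  then show "p \<noteq> {}" unfolding vs(1) path_edges_altdef by blast
  have "card p \<le> length vs - 1"
    unfolding vs(1) path_edges_altdef by (rule order_trans[OF card_image_le]) auto
  with vs(3) show "card p \<le> L" by simp
qed

lemma edge_in_paths_upto:
  assumes "simple_graph q" "e \<in> edges q" "1 \<le> L"
  shows "{e} \<in> paths_upto q L"
proof -
  obtain u v where "u \<in> verts q" "v \<in> verts q" "u \<noteq> v" "e = {u, v}"
    using assms(1,2) by (rule simple_graph_edgeE)
  with assms show ?thesis
    unfolding paths_upto_def
    by (intro CollectI exI[of _ "[u, v]"])
       (auto simp: path_edges_altdef simple_path_def less_Suc_eq)
qed

text \<open>The shared vertex \<open>b\<close> becomes the middle of the path; its ends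
  \<open>a\<close> and \<open>c\<close> differ because otherwise the two edges would
  coincide.\<close>

lemma edge_pair_in_paths_upto:
  assumes q: "simple_graph q" "e \<in> edges q" "f \<in> edges q" "e \<noteq> f" "(e, f) \<in> meets" and "2 \<le> L"
  shows "{e, f} \<in> paths_upto q L"
proof -
  obtain b where b: "b \<in> e" "b \<in> f" using \<open>(e, f) \<in> meets\<close> by (auto simp: meets_def)
  obtain a where a: "a \<in> verts q" "b \<in> verts q" "a \<noteq> b" "e = {a, b}"
    using q(1,2) b(1) by (rule simple_graph_edge_atE)
  obtain c where c: "c \<in> verts q" "b \<in> verts q" "c \<noteq> b" "f = {c, b}"
    using q(1,3) b(2) by (rule simple_graph_edge_atE)
  have "a \<noteq> c" using a c \<open>e \<noteq> f\<close> by auto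
  have "{..<length [a, b, c] - 1} = {0, 1}" by auto
  then have "{e, f} = path_edges [a, b, c]"
    using a c by (simp add: path_edges_altdef insert_commute)
  moreover have "simple_path q [a, b, c]"
    using a c \<open>a \<noteq> c\<close> q by (auto simp: simple_path_def less_Suc_eq insert_commute)
  ultimately show ?thesis
    unfolding paths_upto_def using \<open>2 \<le> L\<close> by (intro CollectI exI[of _ "[a, b, c]"]) auto
qed

text \<open>Removable paths are found in the remaining graph, whereas \<open>ps\<close> enumerates
  the paths of the original one.\<close>

lemma paths_upto_mono:
  assumes "verts q' \<subseteq> verts q" "edges q' \<subseteq> edges q"
  shows "paths_upto q' L \<subseteq> paths_upto q L"
  using assms unfolding paths_upto_def simple_path_def by blast

lemma ex_removable_edge:
  assumes "simple_graph q" "connected_graph q" "edges q \<noteq> {}" "1 \<le> L"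
  obtains p where "p \<in> paths_upto q L" "removable q p"
proof -
  obtain e where "e \<in> edges q" "connected_in meets (edges q - {e})"
    using connected_in_ex_removable[OF finite_edges _ sym_meets connected_line_graph] assms
    by blast
  then show thesis
    using assms by (intro that[of "{e}"] edge_in_paths_upto removable_if_line_graph) auto
qed

lemma ex_removable_two_path:
  assumes "simple_graph q" "connected_graph q" "2 \<le> card (edges q)" "2 \<le> L"
  obtains p where "p \<in> paths_upto q L" "removable q p" "card p = 2"
proof -
  obtain e f where "e \<in> edges q" "f \<in> edges q" "e \<noteq> f" "(e, f) \<in> meets"
    "connected_in meets (edges q - {e, f})"
    using claw_free_ex_removable_pair[OF finite_edges _ sym_meets connected_line_graph
        claw_free_line_graph] assms
    by blast
  then show thesis
    using assms by (intro that[of "{e, f}"] edge_pair_in_paths_upto removable_if_line_graph) auto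
qed

section \<open>The procedure\<close>

lemma find_sorted_card:
  assumes "sorted_wrt (\<lambda>p p'. card p' \<le> card p) ps" "find P ps = Some p" "p' \<in> set ps" "P p'"
  shows "card p' \<le> card p"
  using assms by (induction ps) (auto split: if_splits)

text \<open>Each path contributes at most \<open>L\<close> edges. For \<open>L = 2\<close> this is
  the lower bound that shows compactness.\<close>

lemma card_edges_le_path_cover:
  assumes "simple_graph q" "disjoint_path_cover q L DP"
  shows "card (edges q) \<le> L * card DP"
proof -
  have paths: "DP \<subseteq> paths_upto q L" and covers: "\<forall>e\<in>edges q. \<exists>p\<in>DP. e \<in> p"
    using assms(2) by (auto simp: disjoint_path_cover_def)
  have "DP \<subseteq> Pow (edges q)" using paths paths_upto_subset by blast
  then have "finite DP" using finite_edges[OF assms(1)] by (simp add: finite_subset)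
  have "finite (\<Union> DP)"
    using \<open>DP \<subseteq> Pow (edges q)\<close> finite_edges[OF assms(1)]
    by (meson Sup_le_iff PowD finite_subset subset_iff)
  then have "card (edges q) \<le> card (\<Union> DP)"
    using covers by (intro card_mono) auto
  also have "\<dots> \<le> (\<Sum>p\<in>DP. card p)"
    by (rule card_Union_le_sum_card)
  also have "\<dots> \<le> (\<Sum>p\<in>DP. L)"
    using paths paths_upto_card_le by (intro sum_mono) blast
  finally show ?thesis by (simp add: mult.commute)
qed

text \<open>The remaining edges and the chosen paths partition the edges of \<open>q\<close>. The
  last conjunct says that each chosen path used up two edges; the slack of 1, granted only once no
  edges remain, pays for a final single edge.\<close>

definition cover_invariant ::
    "('v, 'l) lgraph \<Rightarrow> nat \<Rightarrow> ('v, 'l) lgraph \<times> 'v set set set \<Rightarrow> bool" where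
  "cover_invariant q L = (\<lambda>(q', DP).
     simple_graph q' \<and> connected_graph q' \<and> verts q' \<subseteq> verts q \<and> DP \<subseteq> paths_upto q L \<and>
     finite DP \<and> disjoint DP \<and> edges q' \<inter> \<Union> DP = {} \<and> edges q' \<union> \<Union> DP = edges q \<and>
     (L = 2 \<longrightarrow> 2 * card DP + card (edges q') \<le> card (edges q) + (if edges q' = {} then 1 else 0)))"

lemma cover_invariant_step:
  assumes inv: "cover_invariant q L (q', DP)" and enum: "sorted_enumeration (paths_upto q L) ps"
    and find: "find (removable q') ps = Some p"
  shows "cover_invariant q L (delete_path q' p, insert p DP)"
    and "card (edges (delete_path q' p)) < card (edges q')"
proof -
  have q': "simple_graph q'" "connected_graph q'" "verts q' \<subseteq> verts q"
    and DP: "DP \<subseteq> paths_upto q L" "finite DP" "disjoint DP"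
    and part: "edges q' \<inter> \<Union> DP = {}" "edges q' \<union> \<Union> DP = edges q"
    and two: "L = 2 \<Longrightarrow>
      2 * card DP + card (edges q') \<le> card (edges q) + (if edges q' = {} then 1 else 0)"
    using inv by (auto simp: cover_invariant_def)
  have ps: "set ps = paths_upto q L" "sorted_wrt (\<lambda>p p'. card p' \<le> card p) ps"
    using enum by (auto simp: sorted_enumeration_def)
  have "p \<in> set ps" "removable q' p"
    using find by (auto simp: find_Some_iff)
  then have p: "p \<in> paths_upto q L" "p \<subseteq> edges q'" "connected_graph (delete_path q' p)"
    using ps by (auto simp: removable_def)
  note pne = paths_upto_nonempty[OF p(1)] and pfin = paths_upto_finite[OF p(1)]
  have fin: "finite (edges q')" using q'(1) by (rule finite_edges)
  show "card (edges (delete_path q' p)) < card (edges q')"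
    unfolding edges_delete_path using fin p(2) pne by (intro psubset_card_mono) auto
  have "edges q' \<noteq> {}" using p(2) pne by auto
  \<comment> \<open>This makes the number of chosen paths grow by exactly one.\<close>
  have "p \<notin> DP" using p(2) pne part(1) by blast
  have count: "2 * card (insert p DP) + card (edges q' - p)
      \<le> card (edges q) + (if edges q' - p = {} then 1 else 0)" if L: "L = 2"
  proof -
    have bound: "2 * card DP + card (edges q') \<le> card (edges q)"
      using two[OF L] \<open>edges q' \<noteq> {}\<close> by simp
    have diff: "card (edges q' - p) = card (edges q') - card p" "card p \<le> card (edges q')"
      using p(2) fin pfin by (auto intro: card_Diff_subset card_mono)
    have "card p \<noteq> 0" using pne pfin by simp
    show ?thesis
    proof (cases "2 \<le> card (edges q')")
      case True
      \<comment> \<open>A removable two-edge path exists, so the first removable path in the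
        decreasing order has at least two edges as well.\<close>
      obtain p' where p': "p' \<in> paths_upto q' L" "removable q' p'" "card p' = 2"
        using ex_removable_two_path[OF q'(1,2) True] L by blast
      then have "p' \<in> set ps"
        using paths_upto_mono[OF q'(3)] part(2) ps(1) by blast
      then have "2 \<le> card p"
        using find_sorted_card[OF ps(2) find] p' by metis
      then show ?thesis
        using bound diff \<open>p \<notin> DP\<close> DP(2) by simp
    next
      \<comment> \<open>Here \<open>p\<close> is the single remaining edge, and the slack of the
        invariant is spent.\<close>
      case False
      then have "card (edges q') = 1" "card p = 1"
        using diff \<open>card p \<noteq> 0\<close> by linarith+
      then have "edges q' - p = {}"
        using p(2) fin by (metis Diff_cancel card_subset_eq)
      moreover have "card (edges q' - p) = 0" by (simp only: calculation card.empty)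
      ultimately show ?thesis
        using bound \<open>card (edges q') = 1\<close> \<open>p \<notin> DP\<close> DP(2) by simp
    qed
  qed
  have "disjoint (insert p DP)"
    using DP(3) part(1) p(2) by (auto simp: disjoint_def)
  then show "cover_invariant q L (delete_path q' p, insert p DP)"
    unfolding cover_invariant_def
    using p q' DP part count
    by (auto simp: simple_graph_delete_path verts_delete_path)
qed

theorem theorem4p9:
  fixes q :: "('v, 'l) lgraph" and maxL :: nat and ps :: "'v set set list"
  assumes "simple_graph q"
    and "connected_graph q"
    and "maxL \<ge> 1"
    and "sorted_enumeration (paths_upto q maxL) ps"
  shows "\<exists>DP. cover ps q = Some DP \<and> disjoint_path_cover q maxL DP \<and>
           (maxL = 2 \<longrightarrow> compact_path_cover q maxL DP)"
proof -
  let ?b = "\<lambda>(q', DP). \<not> empty_graph q' \<and> find (removable q') ps \<noteq> None"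
  let ?c = "\<lambda>(q', DP). let p = the (find (removable q') ps) in (delete_path q' p, insert p DP)"
  let ?I = "cover_invariant q maxL"
  have init: "?I (q, {})"
    using assms by (simp add: cover_invariant_def)
  \<comment> \<open>The number of remaining edges is the termination measure.\<close>
  have step: "?I (?c s) \<and> card (edges (fst (?c s))) < card (edges (fst s))"
    if "?I s" "?b s" for s
  proof (cases s)
    case (Pair q' DP)
    with that obtain p where "find (removable q') ps = Some p" by auto
    with cover_invariant_step[of q maxL q' DP ps p] that assms(4) Pair show ?thesis
      by (simp add: Let_def)
  qed
  obtain t where t: "while_option ?b ?c (q, {}) = Some t"
    using measure_while_option_Some[where P = ?I and b = ?b and c = ?c and
        f = "\<lambda>s. card (edges (fst s))", OF step init]
    by blast
  obtain q' DP where "t = (q', DP)" by fastforce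
  have inv: "?I (q', DP)"
    using while_option_rule[where P = ?I, OF _ t init] step \<open>t = (q', DP)\<close> by blast
  have stop: "empty_graph q' \<or> find (removable q') ps = None"
    using while_option_stop[OF t] \<open>t = (q', DP)\<close> by simp
  \<comment> \<open>Both exit conditions lead here: while edges remain, some listed path is
    removable. Only edges are claimed to be gone, since a one-vertex \<open>q\<close> is not
    \<open>empty_graph\<close> and stops the loop by having no path.\<close>
  have "edges q' = {}"
  proof (rule ccontr)
    assume "edges q' \<noteq> {}"
    moreover have "simple_graph q'" "connected_graph q'"
      using inv by (auto simp: cover_invariant_def)
    ultimately obtain p where p: "p \<in> paths_upto q' maxL" "removable q' p"
      using ex_removable_edge assms(3) by metis
    have "paths_upto q' maxL \<subseteq> paths_upto q maxL"
      using inv by (intro paths_upto_mono) (auto simp: cover_invariant_def)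
    then have "p \<in> set ps" using p assms(4) by (auto simp: sorted_enumeration_def)
    with p have "find (removable q') ps \<noteq> None" by (auto simp: find_None_iff)
    with stop \<open>edges q' \<noteq> {}\<close> show False by (simp add: empty_graph_def)
  qed
  have cover: "cover ps q = Some DP"
    unfolding cover_def t using \<open>t = (q', DP)\<close> by simp
  have dpc: "disjoint_path_cover q maxL DP"
    using inv \<open>edges q' = {}\<close> by (auto simp: cover_invariant_def disjoint_path_cover_def)
  have "compact_path_cover q maxL DP" if "maxL = 2"
    unfolding compact_path_cover_def
  proof (intro conjI allI impI dpc)
    fix DP' assume "disjoint_path_cover q maxL DP'"
    with card_edges_le_path_cover[OF assms(1)] that have "card (edges q) \<le> 2 * card DP'"
      by blast
    \<comment> \<open>Twice \<open>card DP\<close> exceeds twice \<open>card DP'\<close> by at most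
      1, hence not at all by parity.\<close>
    moreover have "2 * card DP \<le> card (edges q) + 1"
      using inv \<open>edges q' = {}\<close> that by (simp add: cover_invariant_def)
    ultimately show "card DP \<le> card DP'" by simp
  qed
  with cover dpc show ?thesis by blast
qed

end
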